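(* Let $U$ be a uniform ultrafilter over an infinite cardinal $\kappa$. Then $(\mathfrak{ch}(U),\in)\leq_T (U,\supseteq)$.
   Context: An ultrafilter over $\kappa$ is uniform if all its members have cardinality $\kappa$. A set $\mathcal{B}\subseteq U$ generates $U$ if every $X\in U$ contains some $b\in\mathcal{B}$; the character $\mathfrak{ch}(U)$ is the least cardinality of a generating set for $U$, viewed as a directed set under its ordinal order. For directed sets, $\mathbb{P}\leq_T\mathbb{Q}$ means there is a map $\mathbb{P}\to\mathbb{Q}$ sending unbounded subsets (those with no upper bound) to unbounded subsets; $(U,\supseteq)$ is $U$ ordered by reverse inclusion. *)

theory Defs
  imports Main
begin

unbundle cardinal_syntax

text \<open>Cardinals are represented as in the HOL library, by relations \<^term>\<open>r\<close> that satisfy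
  \<^term>\<open>Card_order r\<close>; the corresponding initial ordinal is the set \<^term>\<open>Field r\<close>,
  well-ordered by \<^term>\<open>r\<close> (in the reflexive sense).\<close>

definition ultrafilter_over :: "'a set \<Rightarrow> 'a set set \<Rightarrow> bool" where
  "ultrafilter_over S U \<longleftrightarrow>
     U \<subseteq> Pow S \<and> S \<in> U \<and> {} \<notin> U \<and>
     (\<forall>X\<in>U. \<forall>Y\<in>U. X \<inter> Y \<in> U) \<and>
     (\<forall>X\<in>U. \<forall>Y. X \<subseteq> Y \<and> Y \<subseteq> S \<longrightarrow> Y \<in> U) \<and>
     (\<forall>X. X \<subseteq> S \<longrightarrow> X \<in> U \<or> S - X \<in> U)"

definition uniform_ultrafilter :: "'a rel \<Rightarrow> 'a set set \<Rightarrow> bool" where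
  "uniform_ultrafilter \<kappa> U \<longleftrightarrow> ultrafilter_over (Field \<kappa>) U \<and> (\<forall>X\<in>U. |X| =o \<kappa>)"

definition generates :: "'a set set \<Rightarrow> 'a set set \<Rightarrow> bool" where
  "generates B U \<longleftrightarrow> B \<subseteq> U \<and> (\<forall>X\<in>U. \<exists>b\<in>B. b \<subseteq> X)"

text \<open>Cardinals in this representation are unique only up to \<^term>\<open>(=o)\<close>, so a representative of
  the least one is chosen. The lemmas below show that a least one exists and that the choice of the
  representative has no influence on the Tukey order.\<close>

definition character :: "'a set set \<Rightarrow> 'a set rel" where
  "character U = (SOME c. c \<in> card_of ` {B. generates B U} \<and>
                          (\<forall>c'\<in>card_of ` {B. generates B U}. c \<le>o c'))"

definition unbounded_in :: "'p rel \<Rightarrow> 'p set \<Rightarrow> bool" where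
  "unbounded_in r A \<longleftrightarrow> \<not> (\<exists>b\<in>Field r. \<forall>a\<in>A. (a, b) \<in> r)"

definition tukey_le :: "'p rel \<Rightarrow> 'q rel \<Rightarrow> bool"  (infix "\<le>\<^sub>T" 50) where
  "r \<le>\<^sub>T s \<longleftrightarrow> (\<exists>f. f ` Field r \<subseteq> Field s \<and>
     (\<forall>A. A \<subseteq> Field r \<and> unbounded_in r A \<longrightarrow> unbounded_in s (f ` A)))"

definition directed_set :: "'p rel \<Rightarrow> bool" where
  "directed_set r \<longleftrightarrow> preorder_on (Field r) r \<and> Field r \<noteq> {} \<and>
     (\<forall>x\<in>Field r. \<forall>y\<in>Field r. \<exists>z\<in>Field r. (x, z) \<in> r \<and> (y, z) \<in> r)"

abbreviation reverse_inclusion :: "'a set set \<Rightarrow> 'a set rel" where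
  "reverse_inclusion U \<equiv> relation_of (\<supseteq>) U"

lemma character_least:
  shows "\<exists>B. generates B U \<and> character U = |B|"
    and "generates B U \<Longrightarrow> character U \<le>o |B|"
proof -
  let ?R = "card_of ` {B. generates B U}"
  have "generates U U" by (auto simp: generates_def)
  then have "?R \<noteq> {}" by blast
  moreover have "\<forall>r\<in>?R. Card_order r" using card_of_Card_order by auto
  ultimately have "\<exists>c. c \<in> ?R \<and> (\<forall>c'\<in>?R. c \<le>o c')"
    using exists_minim_Card_order[of ?R] by blast
  then have *: "character U \<in> ?R \<and> (\<forall>c'\<in>?R. character U \<le>o c')"
    unfolding character_def by (rule someI_ex)
  then show "\<exists>B. generates B U \<and> character U = |B|" by auto
  show "generates B U \<Longrightarrow> character U \<le>o |B|" using * by auto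
qed

lemma Card_order_character: "Card_order (character U)"
  using character_least(1)[of U] card_of_Card_order by metis

lemma tukey_le_ordIso_left:
  assumes "r =o r'" and "r \<le>\<^sub>T s"
  shows "r' \<le>\<^sub>T s"
proof -
  from assms(1) have "r' =o r" by (rule ordIso_symmetric)
  then obtain g where g: "iso r' r g" unfolding ordIso_def by auto
  then have bij: "bij_betw g (Field r') (Field r)"
    and emb: "\<And>a b. a \<in> Field r' \<Longrightarrow> b \<in> Field r' \<Longrightarrow> (a, b) \<in> r' \<longleftrightarrow> (g a, g b) \<in> r"
    using iso_iff2[of r' r g] by auto
  from assms(2)[unfolded tukey_le_def] obtain f where "f ` Field r \<subseteq> Field s \<and>
      (\<forall>A. A \<subseteq> Field r \<and> unbounded_in r A \<longrightarrow> unbounded_in s (f ` A))" by (rule exE)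
  then have f: "f ` Field r \<subseteq> Field s"
      "\<And>A. A \<subseteq> Field r \<Longrightarrow> unbounded_in r A \<Longrightarrow> unbounded_in s (f ` A)" by simp_all
  have img: "g ` Field r' = Field r" using bij by (simp add: bij_betw_def)
  have "unbounded_in s ((f \<circ> g) ` A)" if A: "A \<subseteq> Field r'" "unbounded_in r' A" for A
  proof -
    have "unbounded_in r (g ` A)"
      unfolding unbounded_in_def
    proof
      assume "\<exists>b\<in>Field r. \<forall>a\<in>g ` A. (a, b) \<in> r"
      then obtain c where c: "c \<in> Field r" "\<forall>a\<in>A. (g a, c) \<in> r" by auto
      then obtain b where "b \<in> Field r'" "c = g b" using img by (metis imageE)
      with c have b: "b \<in> Field r'" "\<forall>a\<in>A. (g a, g b) \<in> r" by simp_all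
      then have "\<forall>a\<in>A. (a, b) \<in> r'" using emb A(1) by blast
      then show False using A(2) b(1) unfolding unbounded_in_def by blast
    qed
    moreover have "g ` A \<subseteq> Field r" using A(1) img by blast
    ultimately show ?thesis using f(2) unfolding image_comp [symmetric] by simp
  qed
  moreover have "(f \<circ> g) ` Field r' \<subseteq> Field s" using f(1) img by auto
  ultimately show ?thesis unfolding tukey_le_def by (intro exI[of _ "f \<circ> g"]) simp
qed

lemma Field_reverse_inclusion: "Field (reverse_inclusion U) = U"
  by (auto simp: relation_of_def Field_def)

lemma directed_reverse_inclusion:
  assumes "ultrafilter_over S U"
  shows "directed_set (reverse_inclusion U)"
proof -
  have "preorder_on U (reverse_inclusion U)"
    by (auto simp: preorder_on_def refl_on_def trans_def relation_of_def)
  moreover have "\<exists>Z\<in>U. (X, Z) \<in> reverse_inclusion U \<and> (Y, Z) \<in> reverse_inclusion U"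
    if "X \<in> U" "Y \<in> U" for X Y
    using that assms by (intro bexI[of _ "X \<inter> Y"]) (auto simp: ultrafilter_over_def relation_of_def)
  moreover have "U \<noteq> {}" using assms by (auto simp: ultrafilter_over_def)
  ultimately show ?thesis unfolding directed_set_def Field_reverse_inclusion by blast
qed

lemma directed_character:
  assumes "ultrafilter_over S U"
  shows "directed_set (character U)"
proof -
  have lin: "Linear_order (character U)"
    using Card_order_character[of U] unfolding card_order_on_def well_order_on_def by blast
  then have pre: "preorder_on (Field (character U)) (character U)"
    by (simp add: order_on_defs)
  obtain B where B: "generates B U" "character U = |B|" using character_least(1) by blast
  have "B \<noteq> {}" using B(1) assms by (auto simp: generates_def ultrafilter_over_def)
  then have "Field (character U) \<noteq> {}" using B(2) by (simp add: Field_card_of)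
  moreover have "\<exists>z\<in>Field (character U). (x, z) \<in> character U \<and> (y, z) \<in> character U"
    if x: "x \<in> Field (character U)" and y: "y \<in> Field (character U)" for x y
  proof -
    have refl: "(w, w) \<in> character U" if "w \<in> Field (character U)" for w
      using pre that by (auto simp: preorder_on_def refl_on_def)
    have "(x, y) \<in> character U \<or> (y, x) \<in> character U"
      using lin x y refl[OF x] by (cases "x = y") (simp_all add: linear_order_on_def total_on_def)
    then show ?thesis using refl[OF x] refl[OF y] x y by auto
  qed
  ultimately show ?thesis using pre by (simp add: directed_set_def)
qed

end

(* Well-order a generating set B of least cardinality by |B|. The elements below i are too few
   to generate U, so some f i in U contains none of them. A lower bound Y in U of f ` A contains
   some b in B, and b is then an upper bound of A: any a in A above b would give b \<subseteq> Y \<subseteq> f a. *)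
theory Submission
  imports Defs
begin

lemma not_generates_if_less_character:
  assumes "|C| <o character U"
  shows "\<not> generates C U"
  using assms character_least(2) not_ordLess_ordLeq by blast

lemma character_tukey_le_reverse_inclusion:
  "character U \<le>\<^sub>T reverse_inclusion U"
proof -
  obtain B where B: "generates B U" and c: "character U = |B|"
    using character_least(1) by blast
  have "\<exists>X. X \<in> U \<and> (\<forall>b\<in>underS |B| i. \<not> b \<subseteq> X)" if "i \<in> B" for i
  proof -
    \<comment> \<open>Since \<open>|B|\<close> is a cardinal order, not just a well-order, its
      proper initial segments have smaller cardinality.\<close>
    have "|underS |B| i| <o |B|"
      using that by (intro card_of_underS card_of_Card_order) (simp add: Field_card_of)
    then have "\<not> generates (underS |B| i) U"
      using not_generates_if_less_character c by metis
    \<comment> \<open>This leaves only one way for \<open>generates\<close> to fail: some member of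
      \<open>U\<close> includes no element of the segment.\<close>
    moreover have "underS |B| i \<subseteq> U"
      using B FieldI1[of _ i "|B|"] by (auto simp: generates_def underS_def Field_card_of)
    ultimately show ?thesis unfolding generates_def by blast
  qed
  then obtain f where f: "\<And>i. i \<in> B \<Longrightarrow> f i \<in> U"
      "\<And>i b. i \<in> B \<Longrightarrow> b \<in> underS |B| i \<Longrightarrow> \<not> b \<subseteq> f i"
    by metis
  have "unbounded_in (reverse_inclusion U) (f ` A)"
    if A: "A \<subseteq> B" and unb: "unbounded_in |B| A" for A
  proof (rule ccontr)
    assume "\<not> ?thesis"
    then obtain Y where Y: "Y \<in> U" "\<And>a. a \<in> A \<Longrightarrow> Y \<subseteq> f a"
      unfolding unbounded_in_def Field_reverse_inclusion by (auto simp: relation_of_def)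
    obtain b where b: "b \<in> B" "b \<subseteq> Y" using B Y(1) by (auto simp: generates_def)
    obtain a where a: "a \<in> A" "(a, b) \<notin> |B|"
      using unb b(1) by (auto simp: unbounded_in_def Field_card_of)
    \<comment> \<open>Reflexivity rules out \<open>a = b\<close>; totality then turns
      "\<open>a\<close> is not below \<open>b\<close>" into "\<open>b\<close> is strictly below
      \<open>a\<close>".\<close>
    have "refl_on B |B|" "total_on B |B|"
      using card_of_well_order_on[of B] by (simp_all add: order_on_defs)
    then have "b \<noteq> a" "(b, a) \<in> |B|"
      using a b(1) A by (metis refl_onD subsetD total_on_def)+
    then have "b \<in> underS |B| a" by (simp add: underS_def)
    then show False using f(2) a(1) A b(2) Y(2) by blast
  qed
  \<comment> \<open>As \<open>character U\<close> equals \<open>|B|\<close> and is not merely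
    isomorphic to it, its field is \<open>B\<close>, so \<open>f\<close> itself is the Tukey
    map.\<close>
  then show ?thesis
    unfolding tukey_le_def c Field_reverse_inclusion Field_card_of
    using f(1) by (intro exI[of _ f]) blast
qed

theorem mainTheorem7:
  fixes \<kappa> :: "'a rel" and U :: "'a set set"
  assumes "Card_order \<kappa>" and "infinite (Field \<kappa>)"
    and "uniform_ultrafilter \<kappa> U"
  shows "character U \<le>\<^sub>T reverse_inclusion U"
  by (rule character_tukey_le_reverse_inclusion)

end
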